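(* Let $p>2$ be a prime number and let $G\neq\{e\}$ be a finite $p$-group. Then there exists a characteristic subgroup $N$ of $G$, which is moreover invariant under all surjective endomorphisms of $G$, such that: (1) $\log_2|G:N|\leq f^{b(G)+1}(b(G)\log_2 p)$, where $f^k$ denotes the $k$-th iterate of the function $f(x)=x(x+1)$; (2) $cl(N)\leq b(G)+1$.
   Context: For $x\in G$, $b(x):=\log_p|G:Z_G(x)|$ where $Z_G(x)$ is the centralizer of $x$ in $G$, and $b(G):=\max_{g\in G}b(g)$. $cl(N)$ denotes the nilpotency class of $N$. *)

theory Defs
  imports "HOL-Algebra.Algebra" "HOL-Analysis.Analysis"
begin

definition centralizer_elem :: "('a, 'b) monoid_scheme \<Rightarrow> 'a \<Rightarrow> 'a set" where
  "centralizer_elem G x = {y \<in> carrier G. y \<otimes>\<^bsub>G\<^esub> x = x \<otimes>\<^bsub>G\<^esub> y}"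

definition grp_index :: "('a, 'b) monoid_scheme \<Rightarrow> 'a set \<Rightarrow> nat" where
  "grp_index G H = card (rcosets\<^bsub>G\<^esub> H)"

text \<open>b(x) = log_p |G:Z_G(x)| (an integer for a p-group).\<close>
definition b_elem :: "('a, 'b) monoid_scheme \<Rightarrow> nat \<Rightarrow> 'a \<Rightarrow> nat" where
  "b_elem G p x = (THE k. grp_index G (centralizer_elem G x) = p ^ k)"

definition b_grp :: "('a, 'b) monoid_scheme \<Rightarrow> nat \<Rightarrow> nat" where
  "b_grp G p = Max (b_elem G p ` carrier G)"

text \<open>Lower central series of a group N: gamma 0 = N, gamma (k+1) = [gamma k, N]
  (indexing shifted by one: lower_central N k is the usual gamma_{k+1}).\<close>
fun lower_central :: "('a, 'b) monoid_scheme \<Rightarrow> nat \<Rightarrow> 'a set" where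
  "lower_central N 0 = carrier N"
| "lower_central N (Suc k) = generate N
     (\<Union>x \<in> lower_central N k. \<Union>y \<in> carrier N.
        {x \<otimes>\<^bsub>N\<^esub> y \<otimes>\<^bsub>N\<^esub> inv\<^bsub>N\<^esub> x \<otimes>\<^bsub>N\<^esub> inv\<^bsub>N\<^esub> y})"

definition nilpotency_class :: "('a, 'b) monoid_scheme \<Rightarrow> nat" where
  "nilpotency_class N = (LEAST c. lower_central N c = {\<one>\<^bsub>N\<^esub>})"

definition f_iter_base :: "real \<Rightarrow> real" where
  "f_iter_base x = x * (x + 1)"

end

theory Submission
  imports Defs
begin

text \<open>Take \<open>N = C\<^sub>G(G')\<close>; its class is at most \<open>2\<close>, and \<open>N = G\<close> is abelian when
  \<open>b = b(G) = 0\<close>. To bound its index, choose \<open>a\<close> of maximal breadth \<open>b\<close> and at most \<open>b\<close>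
  elements \<open>T\<close> with \<open>G = C\<^sub>G(a) \<langle>T\<rangle>\<close>, and put \<open>V = C\<^sub>G(a, T)\<close>, of index at most
  \<open>p\<^bsup>b(b+1)\<^esup>\<close>. For \<open>u \<in> V\<close> maximality of \<open>b(a)\<close> forces \<open>G = C\<^sub>G(ua) \<langle>T\<rangle>\<close> as well, so every
  conjugate of \<open>ua\<close> is \<open>u\<close> times a \<open>\<langle>T\<rangle>\<close>-conjugate of \<open>a\<close>; hence \<open>[V, G]\<close> lies in
  \<open>\<langle>a, T\<rangle>\<close>. Writing \<open>G = V \<langle>S\<rangle>\<close> with at most \<open>b(b+1)\<close> elements \<open>S\<close>, the commutator
  subgroup lies in \<open>\<langle>a, T, S\<rangle>\<close>, which has \<open>(b+1)\<^sup>2\<close> generators. Therefore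
  \<open>|G : N| \<le> p\<^bsup>b(b+1)(b+1)\<^esup>\<close>, and two iterations of \<open>f\<close> already exceed the exponent.\<close>

section \<open>Centralizers of sets\<close>

definition centralizer :: "('a, 'b) monoid_scheme \<Rightarrow> 'a set \<Rightarrow> 'a set" where
  "centralizer G A = {y \<in> carrier G. \<forall>x\<in>A. y \<otimes>\<^bsub>G\<^esub> x = x \<otimes>\<^bsub>G\<^esub> y}"

lemma centralizer_elem_eq: "centralizer_elem G x = centralizer G {x}"
  by (simp add: centralizer_elem_def centralizer_def)

lemma centralizer_Un: "centralizer G (A \<union> Y) = centralizer G A \<inter> centralizer G Y"
  by (auto simp: centralizer_def)

context group
begin

lemma subgroup_centralizer:
  assumes A: "A \<subseteq> carrier G"
  shows "subgroup (centralizer G A) G"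
proof (rule subgroupI)
  show "centralizer G A \<subseteq> carrier G"
    by (auto simp: centralizer_def)
  show "centralizer G A \<noteq> {}"
    using A by (auto simp: centralizer_def intro!: exI[of _ \<one>])
next
  fix y assume y: "y \<in> centralizer G A"
  have "inv y \<otimes> x = x \<otimes> inv y" if "x \<in> A" for x
  proof -
    have c: "y \<in> carrier G" "x \<in> carrier G" "y \<otimes> x = x \<otimes> y"
      using y A that by (auto simp: centralizer_def)
    have "inv y \<otimes> x = inv y \<otimes> (x \<otimes> y) \<otimes> inv y"
      using c(1,2) by (simp add: m_assoc)
    also have "\<dots> = inv y \<otimes> (y \<otimes> x) \<otimes> inv y"
      by (simp add: c(3))
    also have "\<dots> = x \<otimes> inv y"
      using c(1,2) by (simp flip: m_assoc)
    finally show ?thesis .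
  qed
  then show "inv y \<in> centralizer G A"
    using y by (auto simp: centralizer_def)
next
  fix y z assume "y \<in> centralizer G A" "z \<in> centralizer G A"
  then show "y \<otimes> z \<in> centralizer G A"
    using A by (auto simp: centralizer_def subset_iff) (metis m_assoc)
qed

text \<open>If \<open>z\<close> commutes with \<open>A\<close>, then \<open>A\<close> lies in the
  subgroup \<open>centralizer G {z}\<close>, which therefore contains all of
  \<open>generate G A\<close>. This allows bounds by the number of generators instead of by the
  order of the generated subgroup.\<close>

lemma centralizer_generate:
  assumes A: "A \<subseteq> carrier G"
  shows "centralizer G (generate G A) = centralizer G A"
proof
  show "centralizer G (generate G A) \<subseteq> centralizer G A"
    by (auto simp: centralizer_def intro: generate.incl)
  show "centralizer G A \<subseteq> centralizer G (generate G A)"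
  proof
    fix z assume z: "z \<in> centralizer G A"
    then have zc: "z \<in> carrier G" by (simp add: centralizer_def)
    have "A \<subseteq> centralizer G {z}"
      using z A by (auto simp: centralizer_def)
    then have "generate G A \<subseteq> centralizer G {z}"
      using zc by (intro generate_subgroup_incl subgroup_centralizer) auto
    then show "z \<in> centralizer G (generate G A)"
      using zc by (auto simp: centralizer_def subset_iff)
  qed
qed

section \<open>Counting the cosets of one subgroup met by another\<close>

text \<open>Double counting: the map sending \<open>k\<close> to \<open>H #> k\<close> on
  \<open>K\<close> has all its fibres of size \<open>card (H \<inter> K)\<close>.\<close>

lemma card_cosets_of_subgroup:
  assumes fin: "finite (carrier G)" and H: "subgroup H G" and K: "subgroup K G"
  shows "card ((\<lambda>k. H #> k) ` K) * card (H \<inter> K) = card K"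
proof -
  have finK: "finite K"
    using fin K finite_subset subgroup.subset by blast
  have fibre: "card {k. k \<in> K \<and> H #> k = c} = card (H \<inter> K)"
    if "c \<in> (\<lambda>k. H #> k) ` K" for c
  proof -
    from that obtain k0 where k0: "k0 \<in> K" "c = H #> k0" by blast
    have k0c: "k0 \<in> carrier G" using k0 K subgroup.mem_carrier by metis
    have Hc: "H \<subseteq> carrier G" using H subgroup.subset by blast
    \<comment> \<open>The fibre through \<open>k0\<close> is the translate of
      \<open>H \<inter> K\<close> by \<open>k0\<close>: a quotient \<open>y \<otimes> inv k0\<close>
      of two of its elements lies in both \<open>H\<close> and \<open>K\<close>.\<close>
    have "bij_betw (\<lambda>h. h \<otimes> k0) (H \<inter> K) {k. k \<in> K \<and> H #> k = c}"
      unfolding bij_betw_def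
    proof
      show "inj_on (\<lambda>h. h \<otimes> k0) (H \<inter> K)"
        using Hc k0c by (intro inj_onI) (simp add: subset_iff)
      show "(\<lambda>h. h \<otimes> k0) ` (H \<inter> K) = {k. k \<in> K \<and> H #> k = c}"
      proof (intro equalityI subsetI)
        fix y assume "y \<in> (\<lambda>h. h \<otimes> k0) ` (H \<inter> K)"
        then obtain h where h: "h \<in> H" "h \<in> K" "y = h \<otimes> k0" by blast
        then have "y \<in> H #> k0" by (auto simp: r_coset_def)
        then have "H #> k0 = H #> y" by (rule repr_independence[OF _ k0c H])
        moreover have "y \<in> K" using h k0 K by (simp add: subgroup.m_closed)
        ultimately show "y \<in> {k. k \<in> K \<and> H #> k = c}" using k0 by simp
      next
        fix y assume "y \<in> {k. k \<in> K \<and> H #> k = c}"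
        then have y: "y \<in> K" "H #> y = H #> k0" using k0 by auto
        then have yc: "y \<in> carrier G" using K subgroup.mem_carrier by metis
        have "y \<in> H #> k0" using rcos_self[OF yc H] y by simp
        then obtain h where h: "h \<in> H" "y = h \<otimes> k0" by (auto simp: r_coset_def)
        then have "h = y \<otimes> inv k0" using Hc k0c by (auto simp: m_assoc subset_iff)
        then have "h \<in> K" using y k0 K by (simp add: subgroup.m_closed subgroup.m_inv_closed)
        then show "y \<in> (\<lambda>h. h \<otimes> k0) ` (H \<inter> K)" using h by blast
      qed
    qed
    then show ?thesis using bij_betw_same_card by metis
  qed
  have "card K = (\<Sum>c\<in>(\<lambda>k. H #> k) ` K. card {k. k \<in> K \<and> H #> k = c})"
    using sum.image_gen[OF finK, of "\<lambda>_. 1::nat" "\<lambda>k. H #> k"] by simp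
  then show ?thesis using fibre by simp
qed

lemma cosets_of_subgroup_subset:
  assumes "subgroup K G"
  shows "(\<lambda>k. H #> k) ` K \<subseteq> rcosets H"
  using subgroup.subset[OF assms] by (auto simp: RCOSETS_def)

lemma finite_rcosets: "finite (carrier G) \<Longrightarrow> finite (rcosets H)"
  by (simp add: RCOSETS_def)

lemma card_subgroup_le_index:
  assumes fin: "finite (carrier G)" and H: "subgroup H G" and K: "subgroup K G"
  shows "card K \<le> grp_index G H * card (H \<inter> K)"
proof -
  have "card ((\<lambda>k. H #> k) ` K) \<le> grp_index G H"
    unfolding grp_index_def
    by (intro card_mono finite_rcosets fin cosets_of_subgroup_subset K)
  then show ?thesis
    using card_cosets_of_subgroup[OF assms] by (metis mult_le_mono1)
qed

lemma set_mult_eq_carrier_iff_cosets: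
  assumes H: "subgroup H G" and K: "subgroup K G"
  shows "H <#> K = carrier G \<longleftrightarrow> (\<lambda>k. H #> k) ` K = rcosets H"
proof
  assume HK: "H <#> K = carrier G"
  have "c \<in> (\<lambda>k. H #> k) ` K" if c: "c \<in> rcosets H" for c
  proof -
    from c obtain x where x: "x \<in> carrier G" "c = H #> x" by (auto simp: RCOSETS_def)
    then have "x \<in> H <#> K" using HK by simp
    then obtain h k where hk: "h \<in> H" "k \<in> K" "x = h \<otimes> k"
      by (auto simp: set_mult_def)
    then have "x \<in> H #> k" by (auto simp: r_coset_def)
    then have "H #> k = H #> x"
      by (rule repr_independence[OF _ _ H]) (use hk K in \<open>simp add: subgroup.mem_carrier\<close>)
    then show ?thesis using x hk by auto
  qed
  then show "(\<lambda>k. H #> k) ` K = rcosets H"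
    using cosets_of_subgroup_subset[OF K] by blast
next
  assume cosets: "(\<lambda>k. H #> k) ` K = rcosets H"
  have "x \<in> H <#> K" if x: "x \<in> carrier G" for x
  proof -
    have "H #> x \<in> (\<lambda>k. H #> k) ` K" using cosets x by (auto simp: RCOSETS_def)
    then obtain k where k: "k \<in> K" "H #> x = H #> k" by blast
    then have "x \<in> H #> k" using rcos_self[OF x H] by simp
    then show ?thesis using k by (auto simp: r_coset_def set_mult_def)
  qed
  moreover have "H <#> K \<subseteq> carrier G"
    using set_mult_closed H K subgroup.subset by metis
  ultimately show "H <#> K = carrier G" by blast
qed

text \<open>\<open>H <#> K\<close> is everything exactly when \<open>K\<close> meets each coset of
  \<open>H\<close>, which the fibre count turns into an inequality. It involves \<open>H\<close>
  only through its index and \<open>H \<inter> K\<close>, so a factorization can be transferred from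
  one \<open>H\<close> to another.\<close>

lemma set_mult_eq_carrier_iff:
  assumes fin: "finite (carrier G)" and H: "subgroup H G" and K: "subgroup K G"
  shows "H <#> K = carrier G \<longleftrightarrow> grp_index G H * card (H \<inter> K) \<le> card K"
proof -
  have "\<one> \<in> H \<inter> K" using H K by (simp add: subgroup.one_closed)
  moreover have "finite (H \<inter> K)" using fin H finite_subset subgroup.subset by blast
  ultimately have pos: "card (H \<inter> K) > 0" using card_gt_0_iff by blast
  let ?f = "\<lambda>k. H #> k"
  have "?f ` K = rcosets H \<longleftrightarrow> grp_index G H \<le> card (?f ` K)"
    unfolding grp_index_def
    using cosets_of_subgroup_subset[OF K, of H] finite_rcosets[OF fin, of H]
    by (metis card_seteq order_refl)
  also have "\<dots> \<longleftrightarrow> grp_index G H * card (H \<inter> K) \<le> card (?f ` K) * card (H \<inter> K)"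
    using pos by simp
  finally show ?thesis
    using set_mult_eq_carrier_iff_cosets[OF H K] card_cosets_of_subgroup[OF assms] by simp
qed

lemma grp_index_mult_card:
  assumes "finite (carrier G)" "subgroup H G"
  shows "grp_index G H * card H = card (carrier G)"
  using lagrange_finite[OF assms] by (simp add: grp_index_def Coset.order_def)

section \<open>Indices of centralizers and supplements in p-groups\<close>

text \<open>Adding \<open>x\<close> to \<open>A\<close> intersects the centralizer with that of
  \<open>x\<close>, which costs a factor of at most \<open>m\<close> by
  \<open>card_subgroup_le_index\<close>.\<close>

lemma card_le_centralizer:
  assumes fin: "finite (carrier G)" and A: "A \<subseteq> carrier G"
    and m: "\<And>x. x \<in> carrier G \<Longrightarrow> grp_index G (centralizer_elem G x) \<le> m"
  shows "card (carrier G) \<le> m ^ card A * card (centralizer G A)"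
proof -
  have "finite A" using fin A finite_subset by blast
  then show ?thesis using A
  proof (induction A rule: finite_induct)
    case empty
    then show ?case by (simp add: centralizer_def)
  next
    case (insert x A)
    have eq: "centralizer G (insert x A) = centralizer G {x} \<inter> centralizer G A"
      using centralizer_Un[of G "{x}" A] by simp
    have "card (centralizer G A)
        \<le> grp_index G (centralizer G {x}) * card (centralizer G (insert x A))"
      unfolding eq by (rule card_subgroup_le_index[OF fin]) (use insert.prems in \<open>auto intro: subgroup_centralizer\<close>)
    also have "\<dots> \<le> m * card (centralizer G (insert x A))"
      using m[of x] insert.prems by (simp add: centralizer_elem_eq)
    finally have le: "card (centralizer G A) \<le> m * card (centralizer G (insert x A))" .
    have "card (carrier G) \<le> m ^ card A * card (centralizer G A)"
      using insert by simp
    also have "\<dots> \<le> m ^ card A * (m * card (centralizer G (insert x A)))"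
      by (rule mult_le_mono2[OF le])
    also have "\<dots> = m ^ card (insert x A) * card (centralizer G (insert x A))"
      using insert.hyps by simp
    finally show ?case .
  qed
qed

text \<open>All the cardinalities of sets of cosets below are powers of \<open>p\<close>, so each new generator
  multiplies the number of cosets of \<open>H\<close> that are reached by at least \<open>p\<close>.\<close>

lemma p_group_supplement:
  assumes p: "Factorial_Ring.prime (p::nat)" and card: "card (carrier G) = p ^ n"
    and H: "subgroup H G" and k: "grp_index G H \<le> p ^ k"
  obtains A where "A \<subseteq> carrier G" "finite A" "card A \<le> k" "H <#> generate G A = carrier G"
proof -
  let ?c = "\<lambda>A. (\<lambda>y. H #> y) ` generate G A"
  have p1: "p > 1" using p prime_gt_1_nat by blast
  then have "p ^ n > 0" by simp
  then have fin: "finite (carrier G)" using card card_gt_0_iff by metis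
  have sub: "subgroup (generate G A) G" if "A \<subseteq> carrier G" for A
    using generate_is_subgroup that by blast
  have finc: "finite (?c A)" if "A \<subseteq> carrier G" for A
    using finite_subset[OF cosets_of_subgroup_subset[OF sub[OF that]] finite_rcosets[OF fin]] .
  have pow: "\<exists>i. card (?c A) = p ^ i" if A: "A \<subseteq> carrier G" for A
  proof -
    have "card (generate G A) dvd p ^ n"
      using grp_index_mult_card[OF fin sub[OF A]] card dvd_triv_right by metis
    \<comment> \<open>A set of cosets need not be a group, but its size is a factor of the order of
      \<open>generate G A\<close>.\<close>
    then have "card (?c A) dvd p ^ n"
      using card_cosets_of_subgroup[OF fin H sub[OF A]] dvd_trans dvd_triv_left by metis
    then show ?thesis using divides_primepow_nat[OF p] by blast
  qed
  \<comment> \<open>The first alternative allows the process to stop early, so \<open>card A\<close>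
    is only bounded by \<open>j\<close>.\<close>
  have ex: "\<exists>A\<subseteq>carrier G. finite A \<and> card A \<le> j \<and> (?c A = rcosets H \<or> p ^ j \<le> card (?c A))" for j
  proof (induction j)
    case 0
    have "card (?c {}) > 0"
      using finc[of "{}"] by (auto simp: card_gt_0_iff generate_empty)
    then show ?case by (intro exI[of _ "{}"]) auto
  next
    case (Suc j)
    then obtain A where A: "A \<subseteq> carrier G" "finite A" "card A \<le> j"
      and d: "?c A = rcosets H \<or> p ^ j \<le> card (?c A)" by blast
    show ?case
    proof (cases "?c A = rcosets H")
      case True
      then show ?thesis using A by (intro exI[of _ A]) auto
    next
      case False
      then have "?c A \<subset> rcosets H" using cosets_of_subgroup_subset[OF sub[OF A(1)]] by blast
      then obtain x where x: "x \<in> carrier G" "H #> x \<notin> ?c A"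
        by (auto simp: RCOSETS_def)
      let ?Y = "insert x A"
      have Y: "?Y \<subseteq> carrier G" using x A by blast
      have "generate G A \<subseteq> generate G ?Y" by (rule mono_generate) auto
      moreover have "x \<in> generate G ?Y" by (auto intro: generate.incl)
      ultimately have "?c A \<subset> ?c ?Y" using x(2) by blast
      then have lt: "card (?c A) < card (?c ?Y)" by (rule psubset_card_mono[OF finc[OF Y]])
      obtain i where i: "card (?c A) = p ^ i"
        using pow[OF A(1)] ..
      obtain i' where i': "card (?c ?Y) = p ^ i'"
        using pow[OF Y] ..
      have "i < i'" using lt i i' p1 by simp
      moreover have "j \<le> i" using d False i p1 by simp
      ultimately have "p ^ Suc j \<le> card (?c ?Y)"
        unfolding i' using p1 by (intro power_increasing) auto
      moreover have "card ?Y \<le> Suc j" using A by (simp add: card_insert_if)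
      ultimately show ?thesis using Y A by (intro exI[of _ ?Y]) auto
    qed
  qed
  obtain A where A: "A \<subseteq> carrier G" "finite A" "card A \<le> k"
    and d: "?c A = rcosets H \<or> p ^ k \<le> card (?c A)" using ex by blast
  \<comment> \<open>For \<open>j = k\<close> the second alternative also reaches all cosets, since
    there are at most \<open>p ^ k\<close> of them.\<close>
  have "?c A = rcosets H"
    using d k cosets_of_subgroup_subset[OF sub[OF A(1)], of H] finite_rcosets[OF fin, of H]
    unfolding grp_index_def by (meson card_seteq le_trans)
  then have "H <#> generate G A = carrier G"
    using set_mult_eq_carrier_iff_cosets[OF H sub[OF A(1)]] by simp
  then show thesis using that A by blast
qed

section \<open>Commutators inside a subgroup with few generators\<close>

text \<open>Conjugating both \<open>a\<close> and \<open>u \<otimes> a\<close> by \<open>x\<close>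
  can be done with elements of \<open>generate G T\<close>, and \<open>u\<close> commutes with
  these; comparing the two conjugates isolates the commutator of \<open>u\<close> and
  \<open>x\<close>.\<close>

lemma commutator_mem_generate:
  assumes fin: "finite (carrier G)" and a: "a \<in> carrier G" and T: "T \<subseteq> carrier G"
    and max: "\<And>x. x \<in> carrier G \<Longrightarrow>
      grp_index G (centralizer_elem G x) \<le> grp_index G (centralizer_elem G a)"
    and full: "centralizer_elem G a <#> generate G T = carrier G"
    and u: "u \<in> centralizer G (insert a T)" and x: "x \<in> carrier G"
  shows "inv x \<otimes> inv u \<otimes> x \<otimes> u \<in> generate G (insert a T)"
proof -
  let ?K = "generate G T" and ?L = "generate G (insert a T)"
  have K: "subgroup ?K G" using T generate_is_subgroup by blast
  have L: "subgroup ?L G" using T a by (intro generate_is_subgroup) auto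
  have KL: "?K \<subseteq> ?L" by (rule mono_generate) auto
  have aL: "a \<in> ?L" by (auto intro: generate.incl)
  have uc: "u \<in> carrier G" and ua: "u \<otimes> a = a \<otimes> u" using u by (auto simp: centralizer_def)
  have uaT: "u \<otimes> a \<in> carrier G" using uc a by simp
  have Kc: "t \<in> carrier G" if "t \<in> ?K" for t using K that subgroup.mem_carrier by metis
  have ut: "u \<otimes> t = t \<otimes> u" if "t \<in> ?K" for t
  proof -
    have "u \<in> centralizer G ?K" using u centralizer_generate[OF T] by (auto simp: centralizer_def)
    then show ?thesis using that by (simp add: centralizer_def)
  qed
  \<comment> \<open>Since \<open>u\<close> commutes with \<open>?K\<close>, an element of
    \<open>?K\<close> centralizes \<open>u \<otimes> a\<close> iff it centralizes
    \<open>a\<close>.\<close>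
  have int: "centralizer_elem G (u \<otimes> a) \<inter> ?K = centralizer_elem G a \<inter> ?K"
  proof -
    have "t \<otimes> (u \<otimes> a) = u \<otimes> a \<otimes> t \<longleftrightarrow> t \<otimes> a = a \<otimes> t" if t: "t \<in> ?K" for t
    proof -
      have "t \<otimes> (u \<otimes> a) = u \<otimes> (t \<otimes> a)"
        using ut[OF t] uc a Kc[OF t] by (metis m_assoc)
      then show ?thesis using uc a Kc[OF t] by (simp add: m_assoc)
    qed
    then show ?thesis by (auto simp: centralizer_elem_def)
  qed
  have sub: "subgroup (centralizer_elem G y) G" if "y \<in> carrier G" for y
    using that by (simp add: centralizer_elem_eq subgroup_centralizer)
  \<comment> \<open>With equal intersections, maximality of the index for \<open>a\<close> gives the
    numerical criterion for \<open>u \<otimes> a\<close>.\<close>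
  have "grp_index G (centralizer_elem G (u \<otimes> a)) * card (centralizer_elem G (u \<otimes> a) \<inter> ?K)
      \<le> grp_index G (centralizer_elem G a) * card (centralizer_elem G a \<inter> ?K)"
    unfolding int by (rule mult_le_mono1[OF max[OF uaT]])
  also have "\<dots> \<le> card ?K"
    using set_mult_eq_carrier_iff[OF fin sub[OF a] K] full by simp
  finally have full': "centralizer_elem G (u \<otimes> a) <#> ?K = carrier G"
    using set_mult_eq_carrier_iff[OF fin sub[OF uaT] K] by simp
  have "x \<in> centralizer_elem G (u \<otimes> a) <#> ?K" using x full' by simp
  then obtain y t where y: "y \<in> centralizer_elem G (u \<otimes> a)" "t \<in> ?K" "x = y \<otimes> t"
    by (auto simp: set_mult_def)
  have "x \<in> centralizer_elem G a <#> ?K" using x full by simp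
  then obtain z s where z: "z \<in> centralizer_elem G a" "s \<in> ?K" "x = z \<otimes> s"
    by (auto simp: set_mult_def)
  \<comment> \<open>A left factor that centralizes \<open>c\<close> drops out, so only the
    \<open>?K\<close>-parts \<open>s\<close> and \<open>t\<close> of the two factorizations of
    \<open>x\<close> matter.\<close>
  have conj: "inv (y \<otimes> t) \<otimes> c \<otimes> (y \<otimes> t) = inv t \<otimes> c \<otimes> t"
    if "y \<in> centralizer_elem G c" "c \<in> carrier G" "t \<in> carrier G" for y t c
  proof -
    have yc: "y \<in> carrier G" "y \<otimes> c = c \<otimes> y" using that by (auto simp: centralizer_elem_def)
    have "inv (y \<otimes> t) \<otimes> c \<otimes> (y \<otimes> t) = inv t \<otimes> (inv y \<otimes> (c \<otimes> y)) \<otimes> t"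
      using yc(1) that by (simp add: inv_mult_group m_assoc)
    moreover have "inv y \<otimes> (y \<otimes> c) = c"
      using yc(1) that by (simp flip: m_assoc)
    ultimately show ?thesis using yc(2) by simp
  qed
  define p where "p = inv s \<otimes> a \<otimes> s"
  define q where "q = inv t \<otimes> a \<otimes> t"
  have pL: "p \<in> ?L" "q \<in> ?L"
    unfolding p_def q_def using aL KL z(2) y(2) L
    by (auto intro!: subgroup.m_closed[OF L] subgroup.m_inv_closed[OF L])
  have pc: "p \<in> carrier G" "q \<in> carrier G" using pL L subgroup.mem_carrier by metis+
  have "inv x \<otimes> a \<otimes> x = p"
    unfolding p_def z(3) using conj z a Kc by blast
  moreover have "inv x \<otimes> (u \<otimes> a) \<otimes> x = u \<otimes> q"
  proof -
    have "inv t \<otimes> u = u \<otimes> inv t"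
      using ut[of "inv t"] subgroup.m_inv_closed[OF K y(2)] by simp
    then have "inv t \<otimes> (u \<otimes> a) \<otimes> t = u \<otimes> q"
      unfolding q_def using Kc[OF y(2)] uc a by (metis m_assoc m_closed inv_closed)
    then show ?thesis unfolding y(3) using conj y uaT Kc by metis
  qed
  \<comment> \<open>Conjugation is multiplicative; together with the two values above this
    determines the conjugate of \<open>u\<close>.\<close>
  moreover have "inv x \<otimes> (u \<otimes> a) \<otimes> x = inv x \<otimes> u \<otimes> x \<otimes> (inv x \<otimes> a \<otimes> x)"
  proof -
    have "x \<otimes> (inv x \<otimes> (a \<otimes> x)) = a \<otimes> x" using x a by (simp flip: m_assoc)
    then show ?thesis using x uc a by (simp add: m_assoc)
  qed
  ultimately have eq: "inv x \<otimes> u \<otimes> x \<otimes> p = u \<otimes> q" by simp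
  then have "inv x \<otimes> u \<otimes> x = u \<otimes> q \<otimes> inv p"
    using x uc pc by (simp add: inv_solve_right)
  then have "inv (inv x \<otimes> u \<otimes> x) = inv (u \<otimes> q \<otimes> inv p)" by simp
  then have "inv x \<otimes> inv u \<otimes> x \<otimes> u = p \<otimes> inv q"
    using x uc pc by (simp add: inv_mult_group m_assoc)
  then show ?thesis using pL L by (simp add: subgroup.m_closed subgroup.m_inv_closed)
qed

lemma inv_mult_cancel_left:
  assumes "w \<in> carrier G" "x \<in> carrier G" "y \<in> carrier G"
  shows "inv (w \<otimes> x) \<otimes> (w \<otimes> y) = inv x \<otimes> y"
proof -
  have "inv w \<otimes> (w \<otimes> y) = y" using assms by (simp flip: m_assoc)
  then show ?thesis using assms by (simp add: inv_mult_group m_assoc)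
qed

text \<open>This justifies the definite description in \<open>b_elem\<close>: the index divides
  \<open>p ^ n\<close>, hence is a power of \<open>p\<close>, and its exponent is unique because
  \<open>p > 1\<close>.\<close>

lemma b_elem_eq:
  assumes p: "Factorial_Ring.prime (p::nat)" and card: "card (carrier G) = p ^ n"
    and x: "x \<in> carrier G"
  shows "grp_index G (centralizer_elem G x) = p ^ b_elem G p x"
proof -
  have p1: "p > 1" using p prime_gt_1_nat by blast
  then have "p ^ n > 0" by simp
  then have fin: "finite (carrier G)" using card card_gt_0_iff by metis
  have "subgroup (centralizer_elem G x) G"
    using x by (simp add: centralizer_elem_eq subgroup_centralizer)
  then have "grp_index G (centralizer_elem G x) dvd p ^ n"
    using grp_index_mult_card[OF fin] card by (metis dvd_triv_left)
  then obtain k where k: "grp_index G (centralizer_elem G x) = p ^ k"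
    using divides_primepow_nat[OF p] by blast
  moreover from k have "b_elem G p x = k"
    unfolding b_elem_def using p1 by (intro the_equality) auto
  ultimately show ?thesis by simp
qed

lemma grp_index_centralizer_le:
  assumes fin: "finite (carrier G)" and A: "A \<subseteq> carrier G"
    and m: "\<And>x. x \<in> carrier G \<Longrightarrow> grp_index G (centralizer_elem G x) \<le> m"
  shows "grp_index G (centralizer G A) \<le> m ^ card A"
proof -
  let ?C = "centralizer G A"
  have C: "subgroup ?C G" by (rule subgroup_centralizer[OF A])
  have "card ?C > 0"
    by (rule subgroup.finite_imp_card_positive[OF C fin])
  moreover have "grp_index G ?C * card ?C \<le> m ^ card A * card ?C"
    using grp_index_mult_card[OF fin C] card_le_centralizer[OF fin A m] by simp
  ultimately show ?thesis by simp
qed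

text \<open>Writing elements as products of a factor in \<open>V\<close> and one in
  \<open>generate G S\<close>, both orders of multiplication give the same \<open>V\<close>-part up
  to factors in \<open>R\<close>. The set \<open>Y\<close> consists of \<open>a\<close>,
  \<open>T\<close> and \<open>S\<close>, and \<open>(b + 1) + b * (b + 1)\<close> is
  \<open>(b + 1)\<^sup>2\<close>.\<close>

lemma commutators_in_small_subgroup:
  assumes p: "Factorial_Ring.prime (p::nat)" and card: "card (carrier G) = p ^ n"
    and b: "\<And>x. x \<in> carrier G \<Longrightarrow> grp_index G (centralizer_elem G x) \<le> p ^ b"
    and a: "a \<in> carrier G" "grp_index G (centralizer_elem G a) = p ^ b"
  obtains Y where "Y \<subseteq> carrier G" "card Y \<le> (b + 1)\<^sup>2"
    "\<And>x y. x \<in> carrier G \<Longrightarrow> y \<in> carrier G \<Longrightarrow> x \<otimes> y \<otimes> inv x \<otimes> inv y \<in> generate G Y"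
proof -
  have p1: "p > 1" using p prime_gt_1_nat by blast
  then have "p ^ n > 0" by simp
  then have fin: "finite (carrier G)" using card card_gt_0_iff by metis
  have Ca: "subgroup (centralizer_elem G a) G"
    using a by (simp add: centralizer_elem_eq subgroup_centralizer)
  obtain T where T: "T \<subseteq> carrier G" "finite T" "card T \<le> b"
    and CT: "centralizer_elem G a <#> generate G T = carrier G"
    using p_group_supplement[OF p card Ca] a(2) by (metis order_refl)
  let ?L = "insert a T" and ?V = "centralizer G (insert a T)"
  have Lc: "?L \<subseteq> carrier G" using T a by blast
  have cardL: "card ?L \<le> b + 1" using T by (simp add: card_insert_if)
  have V: "subgroup ?V G" by (rule subgroup_centralizer[OF Lc])
  have "grp_index G ?V \<le> (p ^ b) ^ card ?L"
    by (rule grp_index_centralizer_le[OF fin Lc b])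
  also have "\<dots> \<le> (p ^ b) ^ (b + 1)"
    using cardL p1 by (intro power_increasing) auto
  finally have "grp_index G ?V \<le> p ^ (b * (b + 1))" by (simp only: power_mult)
  then obtain S where S: "S \<subseteq> carrier G" "finite S" "card S \<le> b * (b + 1)"
    and VS: "?V <#> generate G S = carrier G"
    using p_group_supplement[OF p card V] by blast
  let ?Y = "?L \<union> S"
  let ?R = "generate G ?Y"
  have Yc: "?Y \<subseteq> carrier G" using Lc S by blast
  have R: "subgroup ?R G" by (rule generate_is_subgroup[OF Yc])
  have SR: "generate G S \<subseteq> ?R" and LR: "generate G ?L \<subseteq> ?R"
    by (rule mono_generate, blast)+
  define c where "c u x = inv x \<otimes> inv u \<otimes> x \<otimes> u" for u x
  have cR: "c u x \<in> ?R" if "u \<in> ?V" "x \<in> carrier G" for u x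
    unfolding c_def using commutator_mem_generate[OF fin a(1) T(1) _ CT that] b a(2) LR by auto
  \<comment> \<open>Moving \<open>u\<close> to the left past \<open>x\<close> leaves its correction
    on the right. \<open>R\<close> is not known to be normal, so the \<open>V\<close>-factors are
    always moved left, leaving only elements of \<open>R\<close> behind them.\<close>
  have c: "x \<otimes> u = u \<otimes> x \<otimes> c u x" if "u \<in> carrier G" "x \<in> carrier G" for u x
  proof -
    have "u \<otimes> x \<otimes> (inv x \<otimes> inv u) \<otimes> (x \<otimes> u) = x \<otimes> u"
      using that by (simp flip: inv_mult_group)
    then show ?thesis unfolding c_def using that by (simp add: m_assoc)
  qed
  have "x \<otimes> y \<otimes> inv x \<otimes> inv y \<in> ?R" if x: "x \<in> carrier G" and y: "y \<in> carrier G" for x y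
  proof -
    \<comment> \<open>The inverses are factored because the commutator is \<open>inv (inv y
      \<otimes> inv x) \<otimes> (inv x \<otimes> inv y)\<close>, where a common left factor
      \<open>u \<otimes> v\<close> cancels.\<close>
    have "inv x \<in> ?V <#> generate G S" "inv y \<in> ?V <#> generate G S"
      using x y VS by auto
    then obtain u s v t where us: "u \<in> ?V" "s \<in> generate G S" "inv x = u \<otimes> s"
      and vt: "v \<in> ?V" "t \<in> generate G S" "inv y = v \<otimes> t"
      by (auto simp: set_mult_def)
    have uv: "u \<in> carrier G" "v \<in> carrier G" using us vt by (auto simp: centralizer_def)
    have stR: "s \<in> ?R" "t \<in> ?R" using us vt SR by auto
    have st: "s \<in> carrier G" "t \<in> carrier G" using stR R subgroup.mem_carrier by metis+
    have ccR: "c v s \<in> ?R" "c u t \<in> ?R" "c u v \<in> ?R"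
      using cR us vt uv st by auto
    have cc: "c v s \<in> carrier G" "c u t \<in> carrier G" "c u v \<in> carrier G"
      using ccR R subgroup.mem_carrier by metis+
    define k where "k = s \<otimes> c v s \<otimes> t"
    define l where "l = c u v \<otimes> t \<otimes> c u t \<otimes> s"
    have klR: "k \<in> ?R" "l \<in> ?R"
      unfolding k_def l_def by (intro subgroup.m_closed[OF R] stR ccR)+
    have kl: "k \<in> carrier G" "l \<in> carrier G" using klR R subgroup.mem_carrier by metis+
    have "inv x \<otimes> inv y = u \<otimes> (s \<otimes> v) \<otimes> t"
      using us vt uv st by (simp add: m_assoc)
    also have "\<dots> = u \<otimes> v \<otimes> k"
      unfolding c[OF uv(2) st(1)] k_def using uv st cc by (simp add: m_assoc)
    finally have xy: "inv x \<otimes> inv y = u \<otimes> v \<otimes> k" .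
    have "inv y \<otimes> inv x = v \<otimes> (t \<otimes> u) \<otimes> s"
      using us vt uv st by (simp add: m_assoc)
    also have "\<dots> = (v \<otimes> u) \<otimes> t \<otimes> c u t \<otimes> s"
      unfolding c[OF uv(1) st(2)] using uv st cc by (simp add: m_assoc)
    also have "\<dots> = u \<otimes> v \<otimes> l"
      unfolding c[OF uv] l_def using uv st cc by (simp add: m_assoc)
    finally have yx: "inv y \<otimes> inv x = u \<otimes> v \<otimes> l" .
    have "x \<otimes> y \<otimes> inv x \<otimes> inv y = inv (inv y \<otimes> inv x) \<otimes> (inv x \<otimes> inv y)"
      using x y by (simp add: inv_mult_group m_assoc)
    also have "\<dots> = inv l \<otimes> k"
      unfolding xy yx using uv kl by (intro inv_mult_cancel_left) auto
    finally show ?thesis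
      using subgroup.m_closed[OF R subgroup.m_inv_closed[OF R klR(2)] klR(1)] by simp
  qed
  moreover have "card ?Y \<le> (b + 1)\<^sup>2"
    using card_Un_le[of ?L S] cardL S(3) by (simp add: power2_eq_square)
  ultimately show thesis using that[OF Yc] by blast
qed

section \<open>Lower central series and nilpotency class\<close>

lemma lower_central_subset: "lower_central G k \<subseteq> carrier G"
proof (induction k)
  case (Suc k)
  then show ?case
    unfolding lower_central.simps
    by (intro generate_incl) (auto simp: subset_iff)
qed simp

lemma lower_central_nonempty: "lower_central G k \<noteq> {}"
  by (cases k) (auto intro: generate.one)

lemma lower_central_Suc_trivial:
  assumes "lower_central G k \<subseteq> centralizer G (carrier G)"
  shows "lower_central G (Suc k) = {\<one>}"
proof -
  have "x \<otimes> y \<otimes> inv x \<otimes> inv y = \<one>" if "x \<in> lower_central G k" "y \<in> carrier G" for x y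
  proof -
    have x: "x \<in> carrier G" "x \<otimes> y = y \<otimes> x" using assms that by (auto simp: centralizer_def)
    have "y \<otimes> x \<otimes> inv x \<otimes> inv y = y \<otimes> (x \<otimes> inv x) \<otimes> inv y"
      using x(1) that by (simp add: m_assoc del: r_inv)
    then show ?thesis using x that by simp
  qed
  \<comment> \<open>Both index sets are inhabited, so the union below is \<open>{\<one>}\<close> and
    not empty.\<close>
  moreover have "\<exists>x. x \<in> lower_central G k" "\<exists>y. y \<in> carrier G"
    using lower_central_nonempty by blast+
  ultimately have "(\<Union>x \<in> lower_central G k. \<Union>y \<in> carrier G. {x \<otimes> y \<otimes> inv x \<otimes> inv y}) = {\<one>}"
    by auto
  then show ?thesis by (simp add: generate_one)
qed

lemma nilpotency_class_le:
  "lower_central G c = {\<one>} \<Longrightarrow> nilpotency_class G \<le> c"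
  unfolding nilpotency_class_def by (rule Least_le)

end

section \<open>The centralizer of the commutators\<close>

text \<open>The bare set rather than the derived subgroup; the centralizers agree by
  \<open>centralizer_generate\<close>. The shape matches \<open>lower_central\<close>, whose term of
  index 1 is the subgroup generated by this set.\<close>

definition commutators :: "('a, 'b) monoid_scheme \<Rightarrow> 'a set" where
  "commutators G = (\<Union>x \<in> carrier G. \<Union>y \<in> carrier G.
     {x \<otimes>\<^bsub>G\<^esub> y \<otimes>\<^bsub>G\<^esub> inv\<^bsub>G\<^esub> x \<otimes>\<^bsub>G\<^esub> inv\<^bsub>G\<^esub> y})"

context group
begin

lemma commutators_subset: "commutators G \<subseteq> carrier G"
  by (auto simp: commutators_def)

lemma nilpotency_class_le_2:
  assumes "carrier G \<subseteq> centralizer G (commutators G)"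
  shows "nilpotency_class G \<le> 2"
proof -
  have "carrier G \<subseteq> centralizer G (generate G (commutators G))"
    using assms centralizer_generate[OF commutators_subset] by simp
  then have "lower_central G 1 \<subseteq> centralizer G (carrier G)"
    using lower_central_subset[of 1]
    by (fastforce simp: centralizer_def commutators_def)
  then show ?thesis
    using lower_central_Suc_trivial nilpotency_class_le by (metis Suc_1)
qed

text \<open>By surjectivity every commutator is the image of a commutator, so the relation
  \<open>z \<otimes> e = e \<otimes> z\<close> can be pushed forward along \<open>h\<close>.\<close>

lemma surj_hom_centralizer_commutators:
  assumes h: "h \<in> hom G G" and surj: "h ` carrier G = carrier G"
  shows "h ` centralizer G (commutators G) \<subseteq> centralizer G (commutators G)"
proof
  interpret group_hom G G h by unfold_locales (rule h)
  fix w assume "w \<in> h ` centralizer G (commutators G)"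
  then obtain z where z: "z \<in> centralizer G (commutators G)" "w = h z" by blast
  then have zc: "z \<in> carrier G" by (simp add: centralizer_def)
  have "w \<otimes> d = d \<otimes> w" if "d \<in> commutators G" for d
  proof -
    from that obtain x y where xy: "x \<in> carrier G" "y \<in> carrier G"
      "d = h x \<otimes> h y \<otimes> inv (h x) \<otimes> inv (h y)"
      unfolding commutators_def by (subst (asm) (1 2) surj[symmetric]) auto
    let ?e = "x \<otimes> y \<otimes> inv x \<otimes> inv y"
    have "d = h ?e" using xy by simp
    moreover have "z \<otimes> ?e = ?e \<otimes> z"
      using z xy by (auto simp: centralizer_def commutators_def)
    moreover have "?e \<in> carrier G" using xy by simp
    ultimately show ?thesis using zc z(2) by (metis hom_mult)
  qed
  then show "w \<in> centralizer G (commutators G)"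
    using z(2) zc by (simp add: centralizer_def)
qed

text \<open>Commutators of this subgroup are commutators of \<open>G\<close>, which it centralizes
  by definition; so its own derived subgroup is central.\<close>

lemma nilpotency_class_centralizer_commutators:
  "nilpotency_class (G\<lparr>carrier := centralizer G (commutators G)\<rparr>) \<le> 2"
proof -
  let ?N = "centralizer G (commutators G)"
  have N: "subgroup ?N G" by (rule subgroup_centralizer[OF commutators_subset])
  interpret N: group "G\<lparr>carrier := ?N\<rparr>"
    by (rule subgroup.subgroup_is_group[OF N is_group])
  have "commutators (G\<lparr>carrier := ?N\<rparr>) \<subseteq> commutators G"
    using subgroup.subset[OF N] m_inv_consistent[OF N]
    by (fastforce simp: commutators_def)
  then have "carrier (G\<lparr>carrier := ?N\<rparr>)
      \<subseteq> centralizer (G\<lparr>carrier := ?N\<rparr>) (commutators (G\<lparr>carrier := ?N\<rparr>))"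
    by (auto simp: centralizer_def)
  then show ?thesis by (rule N.nilpotency_class_le_2)
qed

end

section \<open>Comparison with the iterates of \<open>f_iter_base\<close>\<close>

lemma f_iter_base_funpow_ge:
  assumes "0 \<le> x"
  shows "x \<le> (f_iter_base ^^ k) x"
proof (induction k)
  case (Suc k)
  have "y \<le> f_iter_base y" if "0 \<le> y" for y
    using that by (simp add: f_iter_base_def algebra_simps)
  from this[of "(f_iter_base ^^ k) x"] show ?case using Suc assms by simp
qed simp

text \<open>With \<open>y = b * L\<close>, two iterations give
  \<open>y * (y + 1) * (y * (y + 1) + 1)\<close>, and each of the last two factors is at least
  \<open>b + 1\<close>. For \<open>b = 0\<close> only one iteration is available, but both sides
  vanish.\<close>

lemma breadth_bound:
  assumes L: "L \<ge> (1::real)"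
  shows "real (b * (b + 1)\<^sup>2) * L \<le> (f_iter_base ^^ (b + 1)) (real b * L)"
proof (cases b)
  case 0
  then show ?thesis by (simp add: f_iter_base_def)
next
  case (Suc d)
  let ?y = "real b * L"
  have y: "real b \<le> ?y" using L by (simp add: mult_le_cancel_left1)
  have "real b + 1 \<le> ?y * (?y + 1) + 1" using y mult_mono[of "real b" ?y 1 "?y + 1"] by simp
  moreover have "real b + 1 \<le> ?y + 1" using y by simp
  ultimately have "?y * ((real b + 1) * (real b + 1)) \<le> ?y * ((?y + 1) * (?y * (?y + 1) + 1))"
    using L by (intro mult_left_mono mult_mono) auto
  then have "real (b * (b + 1)\<^sup>2) * L \<le> f_iter_base (f_iter_base ?y)"
    by (simp add: f_iter_base_def power2_eq_square algebra_simps)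
  \<comment> \<open>Here \<open>b + 1 = d + 2\<close>; the remaining \<open>d\<close> iterations do
    not decrease a nonnegative value.\<close>
  also have "\<dots> \<le> (f_iter_base ^^ d) (f_iter_base (f_iter_base ?y))"
    by (rule f_iter_base_funpow_ge) (use L in \<open>simp add: f_iter_base_def\<close>)
  also have "\<dots> = (f_iter_base ^^ (b + 1)) ?y"
    by (simp add: Suc funpow_swap1)
  finally show ?thesis .
qed

theorem theorem4:
  fixes G :: "('a, 'b) monoid_scheme" and p :: nat
  assumes "Factorial_Ring.prime p" and "p > 2"
    and "group G" and "finite (carrier G)"
    and "\<exists>n. card (carrier G) = p ^ n"
    and "carrier G \<noteq> {\<one>\<^bsub>G\<^esub>}"
  shows "\<exists>N. subgroup N G
    \<and> (\<forall>\<phi> \<in> iso G G. \<phi> ` N = N)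
    \<and> (\<forall>\<phi> \<in> hom G G. \<phi> ` carrier G = carrier G \<longrightarrow> \<phi> ` N \<subseteq> N)
    \<and> log 2 (real (grp_index G N))
        \<le> (f_iter_base ^^ (b_grp G p + 1)) (real (b_grp G p) * log 2 (real p))
    \<and> nilpotency_class (G\<lparr>carrier := N\<rparr>) \<le> b_grp G p + 1"
proof -
  interpret group G by fact
  obtain n where card: "card (carrier G) = p ^ n" using assms(5) by blast
  note fin = assms(4)
  have p1: "p > 1" using assms(2) by simp
  define b where "b = b_grp G p"
  define N where "N = centralizer G (commutators G)"
  have N: "subgroup N G" unfolding N_def by (rule subgroup_centralizer[OF commutators_subset])
  have "b_elem G p x \<le> b" if "x \<in> carrier G" for x
    unfolding b_def b_grp_def using fin that by (intro Max_ge) auto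
  then have le: "grp_index G (centralizer_elem G x) \<le> p ^ b" if "x \<in> carrier G" for x
    using that p1 by (simp add: b_elem_eq[OF assms(1) card])
  have "b \<in> b_elem G p ` carrier G"
    unfolding b_def b_grp_def using fin by (intro Max_in) auto
  then obtain a where a: "a \<in> carrier G" "grp_index G (centralizer_elem G a) = p ^ b"
    using b_elem_eq[OF assms(1) card] by auto

  obtain Y where Y: "Y \<subseteq> carrier G" "card Y \<le> (b + 1)\<^sup>2"
    "\<And>x y. x \<in> carrier G \<Longrightarrow> y \<in> carrier G \<Longrightarrow>
      x \<otimes>\<^bsub>G\<^esub> y \<otimes>\<^bsub>G\<^esub> inv\<^bsub>G\<^esub> x \<otimes>\<^bsub>G\<^esub> inv\<^bsub>G\<^esub> y \<in> generate G Y"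
    using commutators_in_small_subgroup[OF assms(1) card le a] by blast
  have "commutators G \<subseteq> generate G Y" using Y(3) by (auto simp: commutators_def)
  \<comment> \<open>Centralizing \<open>Y\<close> means centralizing \<open>generate G Y\<close>,
    hence all commutators; so the index of \<open>N\<close> is controlled by
    \<open>card Y\<close>.\<close>
  then have "centralizer G Y \<subseteq> N"
    unfolding N_def centralizer_generate[OF Y(1), symmetric] by (auto simp: centralizer_def)
  then have cardN: "card (centralizer G Y) \<le> card N"
    using fin N by (meson card_mono finite_subset subgroup.subset)
  have posN: "card N > 0"
    by (rule subgroup.finite_imp_card_positive[OF N fin])
  have "grp_index G N * card N \<le> (p ^ b) ^ card Y * card (centralizer G Y)"
    using card_le_centralizer[OF fin Y(1) le] grp_index_mult_card[OF fin N] by simp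
  also have "\<dots> \<le> (p ^ b) ^ (b + 1)\<^sup>2 * card N"
    using Y(2) cardN p1 by (intro mult_le_mono power_increasing) auto
  finally have index: "grp_index G N \<le> p ^ (b * (b + 1)\<^sup>2)"
    using posN by (simp add: power_mult)
  \<comment> \<open>Positivity is what monotonicity of the logarithm requires.\<close>
  have "grp_index G N > 0"
    using grp_index_mult_card[OF fin N] card p1 by (cases "grp_index G N = 0") auto
  then have "log 2 (real (grp_index G N)) \<le> log 2 (real (p ^ (b * (b + 1)\<^sup>2)))"
    using index p1 by (subst log_le_cancel_iff) (auto simp flip: of_nat_power)
  also have "\<dots> = real (b * (b + 1)\<^sup>2) * log 2 (real p)"
    using p1 by (simp add: log_nat_power)
  also have "\<dots> \<le> (f_iter_base ^^ (b + 1)) (real b * log 2 (real p))"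
    using p1 by (intro breadth_bound) simp
  finally have log_index: "log 2 (real (grp_index G N)) \<le> \<dots>" .

  have surj: "\<phi> ` N \<subseteq> N" if "\<phi> \<in> hom G G" "\<phi> ` carrier G = carrier G" for \<phi>
    unfolding N_def by (rule surj_hom_centralizer_commutators[OF that])
  \<comment> \<open>An automorphism is a surjective endomorphism, so it maps \<open>N\<close> into
    \<open>N\<close>; injectivity and finiteness give equality.\<close>
  have iso: "\<phi> ` N = N" if \<phi>: "\<phi> \<in> iso G G" for \<phi>
  proof (rule card_subset_eq)
    have bij: "bij_betw \<phi> (carrier G) (carrier G)" and hom: "\<phi> \<in> hom G G"
      using \<phi> by (auto simp: iso_def)
    show "finite N" using N fin finite_subset subgroup.subset by blast
    show "\<phi> ` N \<subseteq> N" using surj hom bij by (simp add: bij_betw_def)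
    have "inj_on \<phi> N"
      using bij N subgroup.subset inj_on_subset by (metis bij_betw_def)
    then show "card (\<phi> ` N) = card N" by (rule card_image)
  qed

  have cl: "nilpotency_class (G\<lparr>carrier := N\<rparr>) \<le> b + 1"
  \<comment> \<open>The bound 2 suffices once \<open>b\<close> is positive. For \<open>b = 0\<close>
    all centralizers have index 1, so \<open>G\<close> is abelian and the class is at most
    1.\<close>
  proof (cases "b = 0")
    case False
    then show ?thesis using nilpotency_class_centralizer_commutators by (simp add: N_def)
  next
    case True
    interpret N: group "G\<lparr>carrier := N\<rparr>" by (rule subgroup.subgroup_is_group[OF N is_group])
    have "x \<otimes>\<^bsub>G\<^esub> y = y \<otimes>\<^bsub>G\<^esub> x" if x: "x \<in> carrier G" and y: "y \<in> carrier G" for x y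
    proof -
      have C: "subgroup (centralizer_elem G y) G"
        using y by (simp add: centralizer_elem_eq subgroup_centralizer)
      have "card (carrier G) \<le> card (centralizer_elem G y)"
        using le[OF y] grp_index_mult_card[OF fin C] True
        by (metis mult_1 mult_le_mono1 power_0)
      then have "centralizer_elem G y = carrier G"
        using card_seteq[OF fin subgroup.subset[OF C]] by simp
      then show ?thesis using x by (auto simp: centralizer_elem_def)
    qed
    then have "lower_central (G\<lparr>carrier := N\<rparr>) 0
        \<subseteq> centralizer (G\<lparr>carrier := N\<rparr>) (carrier (G\<lparr>carrier := N\<rparr>))"
      using subgroup.subset[OF N] by (auto simp: centralizer_def)
    from N.lower_central_Suc_trivial[OF this] show ?thesis
      using N.nilpotency_class_le True by simp
  qed

  show ?thesis
    using N iso surj log_index cl unfolding b_def by blast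
qed

end
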